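(* Let $\Theta\subseteq \mathrm{PD}_m$ be a Gaussian model and let $\Sigma\in\Theta$. Then the logarithmic Voronoi cell $\log\mathrm{Vor}_\Theta(\Sigma)$ is a convex set.
   Context: $\mathrm{PD}_m$ is the cone of real symmetric positive definite $m\times m$ matrices. A Gaussian model (with unrestricted mean) is identified with a set $\Theta\subseteq\mathrm{PD}_m$ of covariance matrices. A positive integer $n$ is fixed. For $\Sigma\in\mathrm{PD}_m$ and a sample covariance matrix $S\in\mathrm{PD}_m$ the log-likelihood function is $$\ell_n(\Sigma,S)=-\tfrac n2\log\det\Sigma-\tfrac n2\mathrm{tr}(S\Sigma^{-1}).$$ The logarithmic Voronoi cell at $\Sigma\in\Theta$ is the set of $S\in\mathrm{PD}_m$ for which $\Sigma$ is a maximizer of $\ell_n(\cdot,S)$ over $\Theta$: $$\log\mathrm{Vor}_\Theta(\Sigma)=\{S\in\mathrm{PD}_m:\ \ell_n(\Sigma,S)\ge \ell_n(\Sigma',S)\text{ for all }\Sigma'\in\Theta\}.$$ *)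

theory Defs
  imports "HOL-Analysis.Analysis"
begin

definition PD :: "(real ^ 'm ^ 'm) set" where
  "PD = {A. transpose A = A \<and> (\<forall>x. x \<noteq> 0 \<longrightarrow> x \<bullet> (A *v x) > 0)}"

definition log_likelihood :: "nat \<Rightarrow> real ^ 'm ^ 'm \<Rightarrow> real ^ 'm ^ 'm \<Rightarrow> real" where
  "log_likelihood n \<Sigma> S =
     - (real n / 2) * ln (det \<Sigma>) - (real n / 2) * trace (S ** matrix_inv \<Sigma>)"

definition log_Vor :: "nat \<Rightarrow> (real ^ 'm ^ 'm) set \<Rightarrow> real ^ 'm ^ 'm \<Rightarrow> (real ^ 'm ^ 'm) set" where
  "log_Vor n \<Theta> \<Sigma> =
     {S \<in> PD. \<forall>\<Sigma>'\<in>\<Theta>. log_likelihood n \<Sigma> S \<ge> log_likelihood n \<Sigma>' S}"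

end

theory Submission
  imports Defs
begin

text \<open>
  For a fixed covariance matrix the log-likelihood is affine in the sample covariance \<open>S\<close>:
  \<open>S\<close> enters only through the trace of \<open>S\<close> times a constant matrix. Comparing two covariance
  matrices therefore cuts out a half-space of matrices \<open>S\<close>, and the logarithmic Voronoi cell is
  the intersection of the convex cone of positive definite matrices with these half-spaces.
\<close>

lemma convex_PD: "convex (PD :: (real ^ 'm ^ 'm) set)"
proof (rule convexI)
  fix A B :: "real ^ 'm ^ 'm" and u v :: real
  assume A: "A \<in> PD" and B: "B \<in> PD" and uv: "0 \<le> u" "0 \<le> v" "u + v = 1"
  let ?C = "u *\<^sub>R A + v *\<^sub>R B"
  have "transpose ?C = u *\<^sub>R transpose A + v *\<^sub>R transpose B"
    by (simp add: transpose_def vec_eq_iff)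
  then have "transpose ?C = ?C"
    using A B by (simp add: PD_def)
  moreover have "x \<bullet> (?C *v x) > 0" if "x \<noteq> 0" for x
  proof -
    have "x \<bullet> (A *v x) > 0" and "x \<bullet> (B *v x) > 0"
      using A B that by (auto simp: PD_def)
    then have "u * (x \<bullet> (A *v x)) + v * (x \<bullet> (B *v x)) > 0"
      using uv by (cases "u = 0") (auto intro: add_pos_nonneg)
    then show ?thesis
      by (simp add: matrix_vector_mult_add_rdistrib scaleR_matrix_vector_assoc[symmetric]
          inner_add_right)
  qed
  ultimately show "?C \<in> PD"
    by (simp add: PD_def)
qed

lemma trace_scaleR: "trace (c *\<^sub>R A) = c * trace (A :: real ^ 'm ^ 'm)"
  by (simp add: trace_def sum_distrib_left)

lemma matrix_mult_add_rdistrib: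
  "(A + B) ** C = A ** C + B ** (C :: 'a :: semiring_1 ^ 'n ^ 'm)"
  by (simp add: matrix_matrix_mult_def vec_eq_iff distrib_right sum.distrib)

text \<open>
  The weights must sum to 1 so that the log-determinant term, which is constant in the sample
  covariance, is reproduced.
\<close>

lemma log_likelihood_affine:
  assumes "u + v = 1"
  shows "log_likelihood n \<Sigma> (u *\<^sub>R S + v *\<^sub>R T)
    = u * log_likelihood n \<Sigma> S + v * log_likelihood n \<Sigma> T"
proof -
  have "trace ((u *\<^sub>R S + v *\<^sub>R T) ** matrix_inv \<Sigma>)
      = u * trace (S ** matrix_inv \<Sigma>) + v * trace (T ** matrix_inv \<Sigma>)"
    by (simp add: matrix_mult_add_rdistrib trace_add trace_scaleR scalar_matrix_assoc[symmetric])
  moreover have "ln (det \<Sigma>) = u * ln (det \<Sigma>) + v * ln (det \<Sigma>)"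
    using assms by (simp flip: distrib_right)
  ultimately show ?thesis
    unfolding log_likelihood_def by algebra
qed

theorem proposition2p3:
  fixes n :: nat
    and \<Theta> :: "(real ^ 'm ^ 'm) set"
    and \<Sigma> :: "real ^ 'm ^ 'm"
  assumes "n > 0"
    and "\<Theta> \<subseteq> PD"
    and "\<Sigma> \<in> \<Theta>"
  shows "convex (log_Vor n \<Theta> \<Sigma>)"
proof (rule convexI)
  fix S T :: "real ^ 'm ^ 'm" and u v :: real
  assume S: "S \<in> log_Vor n \<Theta> \<Sigma>" and T: "T \<in> log_Vor n \<Theta> \<Sigma>"
    and uv: "0 \<le> u" "0 \<le> v" "u + v = 1"
  have "u *\<^sub>R S + v *\<^sub>R T \<in> PD"
    using S T uv by (intro convexD[OF convex_PD]) (auto simp: log_Vor_def)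
  moreover have "log_likelihood n \<Sigma>' (u *\<^sub>R S + v *\<^sub>R T)
      \<le> log_likelihood n \<Sigma> (u *\<^sub>R S + v *\<^sub>R T)" if "\<Sigma>' \<in> \<Theta>" for \<Sigma>'
    using S T uv that
    by (auto simp: log_Vor_def log_likelihood_affine intro!: add_mono mult_left_mono)
  ultimately show "u *\<^sub>R S + v *\<^sub>R T \<in> log_Vor n \<Theta> \<Sigma>"
    by (simp add: log_Vor_def)
qed

end
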